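(* Let $K$ be a field, let $\Gamma=(E,V,s,t)$ be a finite digraph with $V\neq\emptyset$, and let $(\Gamma,\Pi)$ be a separated graph. Then the separated Cohn path algebra $C(\Gamma,\Pi)$ over $K$ has IBN.
   Context: A digraph $\Gamma=(E,V,s,t)$ has vertex set $V$, edge set $E$, and source and target functions $s,t:E\to V$; it is finite if $V$ and $E$ are finite. A sink is a vertex $v$ with $s^{-1}(v)=\emptyset$. A separated graph $(\Gamma,\Pi)$ is a digraph $\Gamma$ together with a partition $\Pi$ of $E$ (into nonempty blocks) which is finer than (possibly equal to) $\{s^{-1}(v)\mid v\in V,\ v\text{ not a sink}\}$. Thus all edges in a block $X\in\Pi$ have the same source. The separated Cohn path algebra $C(\Gamma,\Pi)$ over the field $K$ is the $K$-algebra generated by $\{v\mid v\in V\}\cup\{e,e^*\mid e\in E\}$ subject to the relations: (V) $vw=\delta_{v,w}v$ for all $v,w\in V$; (E1) $s(e)e=e\,t(e)=e$ for all $e\in E$; (E2) $t(e)e^*=e^*s(e)=e^*$ for all $e\in E$; (CK1) for all $X\in\Pi$, $e^*f=\delta_{e,f}\,t(e)$ for all $e,f\in X$. Since $V$ is finite, this algebra is unital with $1=\sum_{v\in V}v$. A unital ring $R$ has IBN (Invariant Basis Number) if $R^m\not\cong R^{m'}$ as right $R$-modules for all distinct positive integers $m\neq m'$. *)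

theory Defs
  imports
    "Graph_Theory.Digraph"
    "HOL-Library.Disjoint_Sets"
    "HOL-Library.Poly_Mapping"
    "HOL-Algebra.QuotRing"
    "HOL-Algebra.Module"
begin

section \<open>Separated graphs\<close>

locale separated_graph = wf_digraph G for G :: "('v, 'e) pre_digraph" +
  fixes P :: "'e set set"
  assumes refines_out_arcs:
    "refines (arcs G) P {out_arcs G v | v. v \<in> verts G \<and> out_arcs G v \<noteq> {}}"


section \<open>Free algebras\<close>

datatype 'g word = Word (letters: "'g list")

instantiation word :: (type) monoid_add
begin

definition zero_word_def: "0 = Word []"

definition plus_word_def: "w + w' = Word (letters w @ letters w')"

instance
  by standard (simp_all add: zero_word_def plus_word_def)

end

text \<open>
  Words are written additively, so that \<^typ>\<open>'g word \<Rightarrow>\<^sub>0 'k::field\<close> carries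
  the convolution product of \<^theory>\<open>HOL-Library.Poly_Mapping\<close>: it is the free
  unital algebra over the field \<^typ>\<open>'k::field\<close>.
\<close>

definition gen :: "'g \<Rightarrow> 'g word \<Rightarrow>\<^sub>0 'k::field" where
  "gen g = Poly_Mapping.single (Word [g]) 1"

definition free_algebra :: "'g set \<Rightarrow> ('g word \<Rightarrow>\<^sub>0 'k::field) ring" where
  "free_algebra A =
    \<lparr>carrier = {p. \<forall>w \<in> Poly_Mapping.keys p. set (letters w) \<subseteq> A},
     mult = (*), one = 1, zero = 0, add = (+)\<rparr>"

text \<open>The non-unital free algebra: no constant term.\<close>

definition augmentation_ideal :: "'g set \<Rightarrow> ('g word \<Rightarrow>\<^sub>0 'k::field) set" where
  "augmentation_ideal A = {p \<in> carrier (free_algebra A). Poly_Mapping.lookup p 0 = 0}"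


section \<open>Separated Cohn path algebras\<close>

datatype ('v, 'e) cohn_generator = Vertex 'v | Edge 'e | Ghost 'e

definition cohn_generators :: "('v, 'e) pre_digraph \<Rightarrow> ('v, 'e) cohn_generator set" where
  "cohn_generators G = Vertex ` verts G \<union> Edge ` arcs G \<union> Ghost ` arcs G"

definition cohn_relations ::
    "('v, 'e) pre_digraph \<Rightarrow> 'e set set \<Rightarrow> (('v, 'e) cohn_generator word \<Rightarrow>\<^sub>0 'k::field) set" where
  "cohn_relations G P =
     {gen (Vertex v) * gen (Vertex w) - (if v = w then gen (Vertex v) else 0) | v w.
        v \<in> verts G \<and> w \<in> verts G} \<union>
     {gen (Vertex (tail G e)) * gen (Edge e) - gen (Edge e) | e. e \<in> arcs G} \<union>
     {gen (Edge e) * gen (Vertex (head G e)) - gen (Edge e) | e. e \<in> arcs G} \<union>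
     {gen (Vertex (head G e)) * gen (Ghost e) - gen (Ghost e) | e. e \<in> arcs G} \<union>
     {gen (Ghost e) * gen (Vertex (tail G e)) - gen (Ghost e) | e. e \<in> arcs G} \<union>
     {gen (Ghost e) * gen (Edge f) - (if e = f then gen (Vertex (head G e)) else 0) | e f X.
        X \<in> P \<and> e \<in> X \<and> f \<in> X}"

definition cohn_ideal ::
    "('v, 'e) pre_digraph \<Rightarrow> 'e set set \<Rightarrow> (('v, 'e) cohn_generator word \<Rightarrow>\<^sub>0 'k::field) set" where
  "cohn_ideal G P = Idl\<^bsub>free_algebra (cohn_generators G)\<^esub> (cohn_relations G P)"

text \<open>
  The algebra is presented by generators and relations as a not necessarily
  unital algebra; its unit, the sum of the vertices, is not imposed by a
  relation. It is therefore the quotient of the non-unital free algebra. The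
  relations have no constant term, and the ideal they generate in the unital free
  algebra equals the algebra ideal they generate in the non-unital one, so
  the quotient is taken inside that of the unital free algebra.
\<close>

definition separated_cohn_path_algebra ::
    "('v, 'e) pre_digraph \<Rightarrow> 'e set set \<Rightarrow> (('v, 'e) cohn_generator word \<Rightarrow>\<^sub>0 'k::field) set ring" where
  "separated_cohn_path_algebra G P =
    (let F = free_algebra (cohn_generators G); I = cohn_ideal G P in
     (F Quot I)
       \<lparr>carrier := (\<lambda>p. I +>\<^bsub>F\<^esub> p) ` augmentation_ideal (cohn_generators G),
        one := I +>\<^bsub>F\<^esub> (\<Sum>v \<in> verts G. gen (Vertex v))\<rparr>)"


section \<open>The separated Cohn path algebra is a unital ring\<close>

lemma free_algebra_simps [simp]:
  "mult (free_algebra A) = (*)" "one (free_algebra A) = 1"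
  "zero (free_algebra A) = 0" "add (free_algebra A) = (+)"
  by (simp_all add: free_algebra_def)

lemma carrier_free_algebra:
  "p \<in> carrier (free_algebra A) \<longleftrightarrow> (\<forall>w \<in> Poly_Mapping.keys p. set (letters w) \<subseteq> A)"
  by (simp add: free_algebra_def)

lemma free_algebra_closed:
  fixes p q :: "'g word \<Rightarrow>\<^sub>0 'k::field"
  assumes "p \<in> carrier (free_algebra A)" "q \<in> carrier (free_algebra A)"
  shows "p + q \<in> carrier (free_algebra A)" "- p \<in> carrier (free_algebra A)"
    "p - q \<in> carrier (free_algebra A)"
    "p * q \<in> carrier (free_algebra A)"
proof -
  show "p + q \<in> carrier (free_algebra A)"
    using assms keys_add[of p q] by (auto simp: carrier_free_algebra)
  show "- p \<in> carrier (free_algebra A)"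
    using assms by (auto simp: carrier_free_algebra)
  show "p - q \<in> carrier (free_algebra A)"
    using assms keys_diff[of p q] by (fastforce simp: carrier_free_algebra)
  show "p * q \<in> carrier (free_algebra A)"
    using assms keys_mult[of p q] by (fastforce simp: carrier_free_algebra plus_word_def)
qed

lemma free_algebra_zero_one [simp]:
  "(0 :: 'g word \<Rightarrow>\<^sub>0 'k::field) \<in> carrier (free_algebra A)"
  "(1 :: 'g word \<Rightarrow>\<^sub>0 'k::field) \<in> carrier (free_algebra A)"
  by (auto simp: carrier_free_algebra zero_word_def)

lemma ring_free_algebra: "ring (free_algebra A :: ('g word \<Rightarrow>\<^sub>0 'k::field) ring)"
proof (rule ringI)
  show "abelian_group (free_algebra A :: ('g word \<Rightarrow>\<^sub>0 'k) ring)"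
  proof (rule abelian_groupI)
    fix x :: "'g word \<Rightarrow>\<^sub>0 'k"
    assume "x \<in> carrier (free_algebra A)"
    then show "\<exists>y\<in>carrier (free_algebra A). y \<oplus>\<^bsub>free_algebra A\<^esub> x = \<zero>\<^bsub>free_algebra A\<^esub>"
      by (intro bexI[of _ "- x"]) (auto simp: free_algebra_closed)
  qed (auto simp: free_algebra_closed algebra_simps)
  show "monoid (free_algebra A :: ('g word \<Rightarrow>\<^sub>0 'k) ring)"
    by (rule monoidI) (auto simp: free_algebra_closed algebra_simps)
qed (auto simp: algebra_simps)

lemma gen_in_carrier: "g \<in> A \<Longrightarrow> (gen g :: 'g word \<Rightarrow>\<^sub>0 'k::field) \<in> carrier (free_algebra A)"
  by (auto simp: carrier_free_algebra gen_def)

lemma lookup_mult_zero: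
  fixes p q :: "'g word \<Rightarrow>\<^sub>0 'k::field"
  shows "Poly_Mapping.lookup (p * q) 0 = Poly_Mapping.lookup p 0 * Poly_Mapping.lookup q 0"
proof -
  have z: "0 = (l::'g word) + m \<longleftrightarrow> l = 0 \<and> m = 0" for l m
    by (cases l; cases m) (auto simp: zero_word_def plus_word_def)
  have "prod_fun (Poly_Mapping.lookup p) (Poly_Mapping.lookup q) 0
     = (\<Sum>l. Poly_Mapping.lookup p l * (\<Sum>m. Poly_Mapping.lookup q m when l = 0 \<and> m = 0))"
    unfolding prod_fun_def z by simp
  also have "\<dots> = (\<Sum>l. (Poly_Mapping.lookup p l * Poly_Mapping.lookup q 0) when l = 0)"
    by (rule Sum_any.cong) (auto simp: when_def)
  also have "\<dots> = Poly_Mapping.lookup p 0 * Poly_Mapping.lookup q 0" by simp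
  finally show ?thesis by (simp add: times_poly_mapping.rep_eq)
qed

lemma cohn_relations_subset:
  assumes "separated_graph G P"
  shows "cohn_relations G P \<subseteq> augmentation_ideal (cohn_generators G)"
proof -
  interpret separated_graph G P by fact
  have arcs: "e \<in> arcs G" if "X \<in> P" "e \<in> X" for X e
    using refines_out_arcs that by (auto simp: refines_def partition_on_def)
  have g: "Vertex v \<in> cohn_generators G" if "v \<in> verts G" for v
    using that by (auto simp: cohn_generators_def)
  have g': "Edge v \<in> cohn_generators G" "Ghost v \<in> cohn_generators G" if "v \<in> arcs G" for v
    using that by (auto simp: cohn_generators_def)
  have l: "Poly_Mapping.lookup (gen g) 0 = 0" for g :: "('a,'b) cohn_generator"
    by (simp add: gen_def lookup_single zero_word_def)
  show ?thesis
    unfolding cohn_relations_def augmentation_ideal_def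
    by (auto simp: lookup_minus lookup_mult_zero l intro!: free_algebra_closed gen_in_carrier g g'
         dest: arcs)
qed

lemma ring_separated_cohn_path_algebra:
  fixes G :: "('v, 'e) pre_digraph"
  assumes "fin_digraph G" "separated_graph G P"
  shows "ring (separated_cohn_path_algebra G P ::
           (('v, 'e) cohn_generator word \<Rightarrow>\<^sub>0 'k::field) set ring)"
proof -
  interpret fin_digraph G by fact
  define A where "A = cohn_generators G"
  define F :: "(('v, 'e) cohn_generator word \<Rightarrow>\<^sub>0 'k) ring" where "F = free_algebra A"
  define S :: "(('v, 'e) cohn_generator word \<Rightarrow>\<^sub>0 'k) set" where "S = cohn_relations G P"
  define I where "I = Idl\<^bsub>F\<^esub> S"
  define C :: "(('v, 'e) cohn_generator word \<Rightarrow>\<^sub>0 'k) set" where "C = augmentation_ideal A"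
  define E :: "('v, 'e) cohn_generator word \<Rightarrow>\<^sub>0 'k" where "E = (\<Sum>v\<in>verts G. gen (Vertex v))"
  define R where "R = (separated_cohn_path_algebra G P ::
           (('v, 'e) cohn_generator word \<Rightarrow>\<^sub>0 'k) set ring)"
  define h where "h = (\<lambda>p. I +>\<^bsub>F\<^esub> p)"
  have SC: "S \<subseteq> C"
    using cohn_relations_subset[OF assms(2)] by (simp add: S_def C_def A_def)
  have CF: "C \<subseteq> carrier F" by (auto simp: C_def F_def augmentation_ideal_def)
  interpret F: ring F unfolding F_def by (rule ring_free_algebra)
  interpret I: ideal I F unfolding I_def using SC CF by (intro F.genideal_ideal) auto
  have SI: "S \<subseteq> I" unfolding I_def using SC CF by (intro F.genideal_self) auto
  have Fs: "mult F = (*)" "one F = 1" "zero F = 0" "add F = (+)" by (simp_all add: F_def)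
  have Cc: "p + q \<in> C" "p * q \<in> C" "- p \<in> C" "0 \<in> C" if "p \<in> C" "q \<in> C" for p q
    using that by (auto simp: C_def augmentation_ideal_def free_algebra_closed lookup_mult_zero lookup_add)
  have C0: "0 \<in> C" by (auto simp: C_def augmentation_ideal_def)
  have Ia: "p + q \<in> I" if "p \<in> I" "q \<in> I" for p q
    using I.a_closed that by (simp add: Fs)
  have Il: "q * p \<in> I" if "p \<in> I" "q \<in> carrier F" for p q
    using I.I_l_closed that by (simp add: Fs)
  have Ir: "p * q \<in> I" if "p \<in> I" "q \<in> carrier F" for p q
    using I.I_r_closed that by (simp add: Fs)
  have I0: "0 \<in> I" using I.zero_closed by (simp add: Fs)
  have Isum: "(\<Sum>x\<in>X. f x) \<in> I" if "\<And>x. x \<in> X \<Longrightarrow> f x \<in> I" for f and X :: "'z set"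
    using that by (induction X rule: infinite_finite_induct) (auto intro: I0 Ia)
  have gF: "gen g \<in> carrier F" if "g \<in> A" for g using that by (simp add: F_def gen_in_carrier)
  have gC: "gen g \<in> C" if "g \<in> A" for g
    using that by (simp add: C_def augmentation_ideal_def carrier_free_algebra gen_def lookup_single zero_word_def)
  have VA: "Vertex v \<in> A" if "v \<in> verts G" for v using that by (auto simp: A_def cohn_generators_def)
  have EC: "E \<in> C"
  proof -
    have "(\<Sum>v\<in>X. gen (Vertex v)) \<in> C" if "X \<subseteq> verts G" for X
      using finite_subset[OF that finite_verts] that
      by (induction X rule: finite_induct) (auto intro!: Cc C0 gC VA)
    then show ?thesis by (simp add: E_def)
  qed
  have EF: "E \<in> carrier F" using EC CF by auto
  have Sv: "gen (Vertex v) * gen (Vertex w) - (if v = w then gen (Vertex v) else 0) \<in> I"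
    if "v \<in> verts G" "w \<in> verts G" for v w
    by (rule subsetD[OF SI], unfold S_def cohn_relations_def, (rule UnI1)+, rule CollectI)
      (use that in blast)
  have S1: "gen (Vertex (tail G e)) * gen (Edge e) - gen (Edge e) \<in> I"
    if "e \<in> arcs G" for e
    by (rule subsetD[OF SI], unfold S_def cohn_relations_def, rule UnI1, rule UnI1, rule UnI1,
        rule UnI1, rule UnI2, rule CollectI) (use that in blast)
  have S2: "gen (Edge e) * gen (Vertex (head G e)) - gen (Edge e) \<in> I"
    if "e \<in> arcs G" for e
    by (rule subsetD[OF SI], unfold S_def cohn_relations_def, rule UnI1, rule UnI1, rule UnI1,
        rule UnI2, rule CollectI) (use that in blast)
  have S3: "gen (Vertex (head G e)) * gen (Ghost e) - gen (Ghost e) \<in> I"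
    if "e \<in> arcs G" for e
    by (rule subsetD[OF SI], unfold S_def cohn_relations_def, rule UnI1, rule UnI1,
        rule UnI2, rule CollectI) (use that in blast)
  have S4: "gen (Ghost e) * gen (Vertex (tail G e)) - gen (Ghost e) \<in> I"
    if "e \<in> arcs G" for e
    by (rule subsetD[OF SI], unfold S_def cohn_relations_def, rule UnI1,
        rule UnI2, rule CollectI) (use that in blast)
  have EvL: "E * gen (Vertex v) - gen (Vertex v) \<in> I" 
    and EvR: "gen (Vertex v) * E - gen (Vertex v) \<in> I" if v: "v \<in> verts G" for v
  proof -
    have d: "gen (Vertex v) = (\<Sum>w\<in>verts G. if w = v then gen (Vertex w) else (0::('v, 'e) cohn_generator word \<Rightarrow>\<^sub>0 'k))"
      "gen (Vertex v) = (\<Sum>w\<in>verts G. if v = w then gen (Vertex v) else (0::('v, 'e) cohn_generator word \<Rightarrow>\<^sub>0 'k))"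
      using v by simp_all
    have *: "E * gen (Vertex v) - gen (Vertex v) =
      (\<Sum>w\<in>verts G. gen (Vertex w) * gen (Vertex v) - (if w = v then gen (Vertex w) else 0))"
      unfolding sum_subtractf E_def sum_distrib_right using d(1) by simp
    show "E * gen (Vertex v) - gen (Vertex v) \<in> I" by (simp only: *) (intro Isum Sv v)
    have **: "gen (Vertex v) * E - gen (Vertex v) =
      (\<Sum>w\<in>verts G. gen (Vertex v) * gen (Vertex w) - (if v = w then gen (Vertex v) else 0))"
      unfolding sum_subtractf E_def sum_distrib_left using d(2) by simp
    show "gen (Vertex v) * E - gen (Vertex v) \<in> I" by (simp only: **) (intro Isum Sv v)
  qed
  have m1: "-1 \<in> carrier F" unfolding F_def by (rule free_algebra_closed(2)[where q = 0]) auto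
  have Im: "- p \<in> I" if "p \<in> I" for p
    using Il[OF that m1] by simp
  have goL: "E * g - g \<in> I" if "v * g - g \<in> I" "E * v - v \<in> I" "v \<in> carrier F" "g \<in> carrier F" for v g
  proof -
    have "E * g - g = - (E * (v * g - g)) + ((E * v - v) * g + (v * g - g))"
      by (simp add: algebra_simps)
    also have "\<dots> \<in> I" using that EF by (intro Ia Im Il Ir) auto
    finally show ?thesis .
  qed
  have goR: "g * E - g \<in> I" if "g * v - g \<in> I" "v * E - v \<in> I" "v \<in> carrier F" "g \<in> carrier F" for v g
  proof -
    have "g * E - g = - ((g * v - g) * E) + (g * (v * E - v) + (g * v - g))"
      by (simp add: algebra_simps)
    also have "\<dots> \<in> I" using that EF by (intro Ia Im Il Ir) auto
    finally show ?thesis .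
  qed
  have AG: "Edge e \<in> A" "Ghost e \<in> A" if "e \<in> arcs G" for e
    using that by (auto simp: A_def cohn_generators_def)
  have EgL: "E * gen g - gen g \<in> I" if "g \<in> A" for g
    using that unfolding A_def cohn_generators_def
    by (auto intro: EvL goL[OF S1] goL[OF S3] gF VA AG tail_in_verts head_in_verts)
  have EgR: "gen g * E - gen g \<in> I" if "g \<in> A" for g
    using that unfolding A_def cohn_generators_def
    by (auto intro: EvR goR[OF S2] goR[OF S4] gF VA AG tail_in_verts head_in_verts)
  have psum: "p = (\<Sum>w\<in>Poly_Mapping.keys p. Poly_Mapping.single w (Poly_Mapping.lookup p w))"
    for p :: "('v, 'e) cohn_generator word \<Rightarrow>\<^sub>0 'k"
    by (rule poly_mapping_eqI) (auto simp: lookup_sum lookup_single when_def in_keys_iff)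
  have mono: "E * Poly_Mapping.single w c - Poly_Mapping.single w c \<in> I \<and>
      Poly_Mapping.single w c * E - Poly_Mapping.single w c \<in> I"
    if w: "set (letters w) \<subseteq> A" "w \<noteq> 0" for w and c :: 'k
  proof
    obtain g gs where gs: "w = Word (g # gs)" using w(2)
      by (metis word.exhaust neq_Nil_conv zero_word_def)
    have "Poly_Mapping.single w c = gen g * Poly_Mapping.single (Word gs) c"
      by (simp add: gs gen_def mult_single plus_word_def)
    moreover have "Poly_Mapping.single (Word gs) c \<in> carrier F"
      using w by (auto simp: F_def carrier_free_algebra gs)
    moreover have "g \<in> A" using w gs by auto
    ultimately show "E * Poly_Mapping.single w c - Poly_Mapping.single w c \<in> I"
      using Ir[OF EgL[of g]] by (simp add: algebra_simps)
    obtain g gs where gs: "w = Word (gs @ [g])" using w(2)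
      by (metis word.exhaust rev_exhaust zero_word_def)
    have "Poly_Mapping.single w c = Poly_Mapping.single (Word gs) c * gen g"
      by (simp add: gs gen_def mult_single plus_word_def)
    moreover have "Poly_Mapping.single (Word gs) c \<in> carrier F"
      using w by (auto simp: F_def carrier_free_algebra gs)
    moreover have "g \<in> A" using w gs by auto
    ultimately show "Poly_Mapping.single w c * E - Poly_Mapping.single w c \<in> I"
      using Il[OF EgR[of g]] by (simp add: algebra_simps)
  qed
  have unit: "E * p - p \<in> I \<and> p * E - p \<in> I" if p: "p \<in> C" for p
  proof -
    have k: "set (letters w) \<subseteq> A \<and> w \<noteq> 0" if "w \<in> Poly_Mapping.keys p" for w
      using p that by (auto simp: C_def augmentation_ideal_def carrier_free_algebra in_keys_iff)
    let ?m = "\<lambda>w. Poly_Mapping.single w (Poly_Mapping.lookup p w)"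
    have "E * p - p = (\<Sum>w\<in>Poly_Mapping.keys p. E * ?m w - ?m w)"
      unfolding sum_subtractf sum_distrib_left[symmetric] psum[symmetric] ..
    moreover have "p * E - p = (\<Sum>w\<in>Poly_Mapping.keys p. ?m w * E - ?m w)"
      unfolding sum_subtractf sum_distrib_right[symmetric] psum[symmetric] ..
    ultimately show ?thesis using mono k by (metis (no_types, lifting) Isum)
  qed
  have hadd: "h p <+>\<^bsub>F\<^esub> h q = h (p + q)" if "p \<in> carrier F" "q \<in> carrier F" for p q
    using I.a_rcos_sum that by (simp add: h_def Fs)
  have hmul: "rcoset_mult F I (h p) (h q) = h (p * q)" if "p \<in> carrier F" "q \<in> carrier F" for p q
    using I.rcoset_mult_add that by (simp add: h_def Fs)
  have heq: "h p = h q" if "p - q \<in> I" "p \<in> carrier F" "q \<in> carrier F" for p q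
  proof -
    have "p = (p - q) \<oplus>\<^bsub>F\<^esub> q" by (simp add: Fs)
    then have "p \<in> I +>\<^bsub>F\<^esub> q" using that(1) unfolding a_r_coset_def' by blast
    then show ?thesis unfolding h_def using I.a_repr_independence' that(3) by metis
  qed
  have h0: "I = h 0" using F.a_coset_add_zero[of I] I.a_subset by (simp add: h_def Fs)
  have Rs: "carrier R = h ` C" "mult R = rcoset_mult F I" "one R = h E" "zero R = h 0" "add R = set_add F"
    using h0 unfolding R_def separated_cohn_path_algebra_def Let_def FactRing_def cohn_ideal_def
    by (simp_all add: h_def C_def E_def A_def I_def F_def S_def)
  have Radd: "h p \<oplus>\<^bsub>R\<^esub> h q = h (p + q)" and Rmul: "h p \<otimes>\<^bsub>R\<^esub> h q = h (p * q)"
    if "p \<in> C" "q \<in> C" for p q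
    using hadd[OF subsetD[OF CF that(1)] subsetD[OF CF that(2)]] hmul[OF subsetD[OF CF that(1)] subsetD[OF CF that(2)]]
    by (simp_all add: Rs)
  have "ring R"
  proof (rule ringI)
    show "abelian_group R"
    proof (rule abelian_groupI)
      fix x assume "x \<in> carrier R"
      then obtain p where p: "x = h p" "p \<in> C" by (auto simp: Rs)
      then show "\<exists>y\<in>carrier R. y \<oplus>\<^bsub>R\<^esub> x = \<zero>\<^bsub>R\<^esub>"
        by (intro bexI[of _ "h (- p)"]) (auto simp: Radd Cc Rs(1,4))
    qed (auto simp: Rs(1,4) Radd Cc C0 algebra_simps)
    show "monoid R"
    proof (rule monoidI)
      fix x assume "x \<in> carrier R"
      then obtain p where p: "x = h p" "p \<in> C" by (auto simp: Rs)
      have "p \<in> carrier F" "E * p \<in> carrier F" "p * E \<in> carrier F" using p EC CF Cc by auto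
      then show "\<one>\<^bsub>R\<^esub> \<otimes>\<^bsub>R\<^esub> x = x" "x \<otimes>\<^bsub>R\<^esub> \<one>\<^bsub>R\<^esub> = x"
        using p EC unit[of p] heq by (auto simp: Rs(3) Rmul)
    qed (auto simp: Rs(1,3) Rmul Cc EC algebra_simps)
  qed (auto simp: Rs(1) Radd Rmul Cc algebra_simps)
  then show ?thesis by (simp add: R_def)
qed


section \<open>Invariant basis number\<close>

text \<open>
  The record type \<^typ>\<open>('a, 'm) module\<close> is used only as a signature:
  \<^term>\<open>r \<odot>\<^bsub>M\<^esub> x\<close> stands for the right action of \<^term>\<open>r\<close> on \<^term>\<open>x\<close>,
  and the fields \<^const>\<open>mult\<close> and \<^const>\<open>one\<close> play no role.
\<close>

definition free_right_module :: "('a, 'b) ring_scheme \<Rightarrow> nat \<Rightarrow> ('a, nat \<Rightarrow> 'a) module" where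
  "free_right_module R m =
    \<lparr>carrier = {..<m} \<rightarrow>\<^sub>E carrier R, mult = undefined, one = undefined,
     zero = (\<lambda>i\<in>{..<m}. \<zero>\<^bsub>R\<^esub>),
     add = (\<lambda>x y. \<lambda>i\<in>{..<m}. x i \<oplus>\<^bsub>R\<^esub> y i),
     smult = (\<lambda>r x. \<lambda>i\<in>{..<m}. x i \<otimes>\<^bsub>R\<^esub> r)\<rparr>"

definition right_module_isomorphic ::
    "('a, 'b) ring_scheme \<Rightarrow> ('a, 'm, 'c) module_scheme \<Rightarrow> ('a, 'n, 'd) module_scheme \<Rightarrow> bool" where
  "right_module_isomorphic R M N \<longleftrightarrow>
    (\<exists>\<phi>. bij_betw \<phi> (carrier M) (carrier N) \<and>
      (\<forall>x \<in> carrier M. \<forall>y \<in> carrier M. \<phi> (x \<oplus>\<^bsub>M\<^esub> y) = \<phi> x \<oplus>\<^bsub>N\<^esub> \<phi> y) \<and>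
      (\<forall>x \<in> carrier M. \<forall>r \<in> carrier R. \<phi> (r \<odot>\<^bsub>M\<^esub> x) = r \<odot>\<^bsub>N\<^esub> \<phi> x))"

definition has_IBN :: "('a, 'b) ring_scheme \<Rightarrow> bool" where
  "has_IBN R \<longleftrightarrow> ring R \<and>
    (\<forall>m n. 0 < m \<and> 0 < n \<and> m \<noteq> n \<longrightarrow>
      \<not> right_module_isomorphic R (free_right_module R m) (free_right_module R n))"

end

theory Submission
  imports Defs
begin

text \<open>
  The \<open>K\<close>-theory class of \<open>1\<close> in the separated Cohn path algebra \<open>R\<close> has infinite order,
  because for each vertex \<open>v\<close> the Cohn relations relate \<open>v\<close> to its out-neighbours only up to a
  complementary projection, on which they put no constraint. The proof detects this with an
  index, that is, with a pair of representations of \<open>R\<close> whose difference has finite rank. An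
  index is an integer, so the argument is the same in every characteristic; a trace of \<open>R\<close> with
  values in a field \<open>K\<close> of positive characteristic \<open>p\<close> would separate ranks only modulo \<open>p\<close>.

  Let \<open>B\<close> be the set of pairs \<open>(v, es)\<close> of a vertex and a list of edges. Both representations
  live on functions \<open>B \<rightarrow> K\<close>, on which generators act by pulling back along partial injections
  of \<open>B\<close>: a vertex \<open>u\<close> is the identity where the first component is \<open>u\<close>, an edge \<open>e\<close> pops the
  letter \<open>e\<close> off the list and moves from the source to the target of \<open>e\<close>, and \<open>e\<^sup>*\<close> is the
  inverse of \<open>e\<close>. This is \<open>path_step\<close>; it gives a representation \<open>\<rho>\<close> in which \<open>1\<close> is the
  identity. Forbidding the finitely many states \<open>(v, [])\<close> gives a second representation \<open>\<sigma>\<close>, in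
  which \<open>1\<close> acts as the projection that kills these \<open>|V|\<close> coordinates
  (\<open>path_step_relations\<close>, \<open>word_operator_cohn_unit\<close>). Because each word moves states injectively,
  only finitely many states pass through a forbidden one, and so \<open>\<rho>(a) f\<close> and
  \<open>\<sigma>(a) f\<close> differ in finitely many coordinates, which depend only on \<open>a\<close>
  (\<open>finite_word_operator_avoid_neq\<close>).

  An isomorphism \<open>R\<^sup>m \<cong> R\<^sup>n\<close> is given by an invertible matrix \<open>A\<close>. The operator \<open>\<rho>(A)\<close> is
  bijective, so its index is \<open>0\<close>, while \<open>\<sigma>(A)\<close> has a kernel of dimension \<open>m |V|\<close> and a
  cokernel of dimension \<open>n |V|\<close>. A perturbation of finite rank does not change the index, hence
  \<open>m |V| = n |V|\<close>. The invariance needed here is \<open>finite_perturbation_defect_le\<close>, and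
  \<open>free_ranks_eq_of_finite_difference\<close> is the resulting criterion for an arbitrary ring.
\<close>

section \<open>Linear operators between function spaces\<close>

definition linear_operator :: "(('s \<Rightarrow> 'k::field) \<Rightarrow> 't \<Rightarrow> 'k) \<Rightarrow> bool" where
  "linear_operator T \<longleftrightarrow>
    (\<forall>f g. T (\<lambda>x. f x + g x) = (\<lambda>y. T f y + T g y)) \<and>
    (\<forall>c f. T (\<lambda>x. c * f x) = (\<lambda>y. c * T f y))"

lemma linear_operatorD:
  assumes "linear_operator T"
  shows "T (\<lambda>x. f x + g x) y = T f y + T g y" "T (\<lambda>x. c * f x) y = c * T f y"
  using assms unfolding linear_operator_def by (auto dest: fun_cong)

lemma linear_operator_zero:
  assumes "linear_operator T"
  shows "T (\<lambda>x. 0) y = 0"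
  using linear_operatorD(2)[OF assms, of 0 "\<lambda>x. 0" y] by simp

lemma linear_operator_sum:
  assumes "linear_operator T"
  shows "T (\<lambda>x. \<Sum>i\<in>I. f i x) y = (\<Sum>i\<in>I. T (f i) y)"
  by (induction I rule: infinite_finite_induct)
    (simp_all add: linear_operatorD(1)[OF assms] linear_operator_zero[OF assms])

text \<open>
  Gaussian elimination: an equation with a nonzero coefficient at some unknown \<open>r\<close> is solved for
  \<open>r\<close> and substituted into the other equations, which removes one equation and one unknown.
\<close>

lemma nonzero_solution_of_homogeneous_system:
  fixes a :: "'t \<Rightarrow> 's \<Rightarrow> 'k::field"
  assumes "finite T" "finite S" "card T < card S"
  shows "\<exists>u. (\<exists>s\<in>S. u s \<noteq> 0) \<and> (\<forall>t\<in>T. (\<Sum>s\<in>S. a t s * u s) = 0)"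
  using assms
proof (induction T arbitrary: S a rule: finite_induct)
  case empty
  then have "S \<noteq> {}" by auto
  then show ?case by (intro exI[of _ "\<lambda>_. 1"]) auto
next
  case (insert t T)
  show ?case
  proof (cases "\<forall>s\<in>S. a t s = 0")
    case True
    obtain u where "\<exists>s\<in>S. u s \<noteq> 0" "\<forall>t\<in>T. (\<Sum>s\<in>S. a t s * u s) = 0"
      using insert.IH[of S a] insert.prems insert.hyps by auto
    with True show ?thesis by (intro exI[of _ u]) auto
  next
    case False
    then obtain r where r: "r \<in> S" "a t r \<noteq> 0" by blast
    define b where "b t' s = a t' s - a t' r * a t s / a t r" for t' s
    have card: "card T < card (S - {r})"
      using insert.prems insert.hyps r by simp
    obtain u where u: "\<exists>s\<in>S - {r}. u s \<noteq> 0" "\<forall>t'\<in>T. (\<Sum>s\<in>S - {r}. b t' s * u s) = 0"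
      using insert.IH[of "S - {r}" b] insert.prems card by auto
    define z where "z = - (\<Sum>s\<in>S - {r}. a t s * u s) / a t r"
    define w where "w = u(r := z)"
    have split: "(\<Sum>s\<in>S. a t' s * w s) = a t' r * z + (\<Sum>s\<in>S - {r}. a t' s * u s)" for t'
    proof -
      have "(\<Sum>s\<in>S. a t' s * w s) = a t' r * w r + (\<Sum>s\<in>S - {r}. a t' s * w s)"
        using insert.prems r by (simp add: sum.remove)
      also have "(\<Sum>s\<in>S - {r}. a t' s * w s) = (\<Sum>s\<in>S - {r}. a t' s * u s)"
        by (rule sum.cong) (auto simp: w_def)
      finally show ?thesis by (simp add: w_def)
    qed
    have "(\<Sum>s\<in>S. a t s * w s) = 0"
      using r by (simp add: split z_def)
    moreover have "(\<Sum>s\<in>S. a t' s * w s) = 0" if "t' \<in> T" for t'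
    proof -
      have "(\<Sum>s\<in>S - {r}. b t' s * u s) =
          (\<Sum>s\<in>S - {r}. a t' s * u s - a t' r / a t r * (a t s * u s))"
        by (rule sum.cong) (auto simp: b_def algebra_simps)
      also have "\<dots> = (\<Sum>s\<in>S - {r}. a t' s * u s) + a t' r * z"
        by (simp add: sum_subtractf sum_distrib_left[symmetric] sum_divide_distrib[symmetric] mult.assoc z_def)
      finally show ?thesis using u(2) that by (simp add: split add.commute)
    qed
    moreover have "\<exists>s\<in>S. w s \<noteq> 0" using u(1) by (auto simp: w_def)
    ultimately show ?thesis by (intro exI[of _ w]) auto
  qed
qed

text \<open>
  Restricting to functions supported on \<open>S\<close> and to the coordinates in \<open>T\<close> turns \<open>L\<close> into an
  injective linear map from \<open>K\<^sup>S\<close> to \<open>K\<^sup>T\<close>.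
\<close>

lemma card_le_of_injective_operator:
  fixes L :: "('s \<Rightarrow> 'k::field) \<Rightarrow> 't \<Rightarrow> 'k"
  assumes "linear_operator L" "finite S" "finite T"
    and inj: "\<And>u s. \<lbrakk>\<And>s. s \<notin> S \<Longrightarrow> u s = 0; \<And>t. t \<in> T \<Longrightarrow> L u t = 0\<rbrakk> \<Longrightarrow> u s = 0"
  shows "card S \<le> card T"
proof (rule ccontr)
  assume "\<not> card S \<le> card T"
  define d :: "'s \<Rightarrow> 's \<Rightarrow> 'k" where "d s r = (if r = s then 1 else 0)" for s r
  obtain u where u: "\<exists>s\<in>S. u s \<noteq> 0" "\<forall>t\<in>T. (\<Sum>s\<in>S. L (d s) t * u s) = 0"
    using nonzero_solution_of_homogeneous_system[OF assms(3,2), of "\<lambda>t s. L (d s) t"]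
      \<open>\<not> card S \<le> card T\<close> by auto
  define w where "w r = (\<Sum>s\<in>S. u s * d s r)" for r
  have w: "w r = (if r \<in> S then u r else 0)" for r
    using assms(2) by (simp add: w_def d_def if_distrib cong: if_cong)
  have "L w t = (\<Sum>s\<in>S. L (d s) t * u s)" for t
    unfolding w_def linear_operator_sum[OF assms(1)] linear_operatorD(2)[OF assms(1)]
    by (simp add: mult.commute)
  then have "w s = 0" for s using inj[of w s] u(2) by (simp add: w)
  then show False using u(1) w by metis
qed

text \<open>
  Half of the invariance of the Fredholm index under perturbations of finite rank, for operators
  between functions on \<open>M\<close> and functions on \<open>N\<close>. The operator \<open>X'\<close> is a left inverse of \<open>X\<close>;
  its perturbation \<open>Y'\<close> differs from it in the finitely many coordinates \<open>D\<close>, misses the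
  coordinates \<open>M0\<close>, and is inverted by \<open>Y\<close> on functions supported on \<open>N - N0\<close>.

  The map \<open>u \<mapsto> Y' (X u)\<close> fixes \<open>u\<close> outside \<open>D\<close>, so it preserves the functions supported on
  the finite set \<open>S = (D \<inter> M) \<union> M0\<close>, and it makes them vanish on \<open>M0\<close>. What it kills is still
  recognised by the values of \<open>X u\<close> on \<open>N0\<close>, as the other values of \<open>X u\<close> are recovered from
  \<open>Y' (X u)\<close> by \<open>Y\<close>. This gives an injection from \<open>K\<^sup>S\<close> into the direct sum of
  \<open>K\<^bsup>S - M0\<^esup>\<close> and \<open>K\<^bsup>N0\<^esup>\<close>, and counting dimensions gives the bound.
\<close>

lemma finite_perturbation_defect_le:
  fixes X :: "('s \<Rightarrow> 'k::field) \<Rightarrow> 't \<Rightarrow> 'k"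
  assumes lin: "linear_operator X" "linear_operator Y" "linear_operator Y'"
    and M0: "finite M0" "M0 \<subseteq> M" and N0: "finite N0"
    and X_range: "\<And>u t. t \<notin> N \<Longrightarrow> X u t = 0"
    and Y'_range: "\<And>v s. s \<notin> M - M0 \<Longrightarrow> Y' v s = 0"
    and X'X: "\<And>u s. X' (X u) s = (if s \<in> M then u s else 0)"
    and YY': "\<And>v t. Y (Y' v) t = (if t \<in> N - N0 then v t else 0)"
    and D: "finite D" "\<And>v s. s \<notin> D \<Longrightarrow> X' v s = Y' v s"
  shows "card M0 \<le> card N0"
proof -
  define S where "S = (D \<inter> M) \<union> M0"
  define L where "L u = (\<lambda>t. case t of Inl s \<Rightarrow> Y' (X u) s | Inr t \<Rightarrow> X u t)" for u
  have finS: "finite S" using M0 D by (simp add: S_def)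
  have "linear_operator L"
    using lin unfolding linear_operator_def L_def
    by (auto intro!: ext split: sum.splits)
  then have "card S \<le> card ((S - M0) <+> N0)"
  proof (rule card_le_of_injective_operator[OF _ finS])
    show "finite ((S - M0) <+> N0)" using finS N0 by simp
    fix u s
    assume u: "\<And>s. s \<notin> S \<Longrightarrow> u s = 0" and 0: "\<And>t. t \<in> (S - M0) <+> N0 \<Longrightarrow> L u t = 0"
    have Y'X: "Y' (X u) s = 0" for s
    proof (cases "s \<in> M - M0")
      case True
      show ?thesis
      proof (cases "s \<in> S")
        case True
        then show ?thesis using 0[of "Inl s"] \<open>s \<in> M - M0\<close> by (auto simp: L_def)
      next
        case False
        then have "Y' (X u) s = X' (X u) s" using True D(2) by (simp add: S_def)
        then show ?thesis using u[OF False] by (simp add: X'X)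
      qed
    qed (simp add: Y'_range)
    have "X u t = 0" for t
    proof (cases "t \<in> N - N0")
      case True
      then have "X u t = Y (Y' (X u)) t" by (simp add: YY')
      also have "Y' (X u) = (\<lambda>s. 0)" using Y'X by auto
      finally show ?thesis using linear_operator_zero[OF lin(2)] by simp
    next
      case False
      then show ?thesis using X_range 0[of "Inr t"] by (auto simp: L_def)
    qed
    then have "X u = (\<lambda>t. 0)" by auto
    moreover have "X' (\<lambda>t. 0) s = 0"
    proof -
      have "X (\<lambda>s. 0) = (\<lambda>t. 0)" using linear_operator_zero[OF lin(1)] by auto
      then show ?thesis using X'X[of "\<lambda>s. 0" s] by simp
    qed
    moreover have "s \<notin> M \<Longrightarrow> u s = 0"
      using u M0 by (auto simp: S_def)
    ultimately show "u s = 0" using X'X[of u s] by (auto split: if_splits)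
  qed
  also have "\<dots> = card S - card M0 + card N0"
    using finS M0 N0 by (simp add: card_Plus card_Diff_subset S_def)
  finally show ?thesis
    using card_mono[OF finS, of M0] by (simp add: S_def)
qed

section \<open>Rings acting on function spaces\<close>

locale function_representation = ring R for R :: "('a, 'c) ring_scheme" (structure) +
  fixes act :: "'a \<Rightarrow> ('b \<Rightarrow> 'k::field) \<Rightarrow> 'b \<Rightarrow> 'k"
  assumes act_linear: "a \<in> carrier R \<Longrightarrow> linear_operator (act a)"
    and act_add: "\<lbrakk>a \<in> carrier R; b \<in> carrier R\<rbrakk> \<Longrightarrow> act (a \<oplus> b) f x = act a f x + act b f x"
    and act_mult: "\<lbrakk>a \<in> carrier R; b \<in> carrier R\<rbrakk> \<Longrightarrow> act (a \<otimes> b) f = act a (act b f)"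
begin

lemma act_zero: "act \<zero> f x = 0"
  using act_add[of \<zero> \<zero> f x] by (metis add_cancel_left_left l_zero zero_closed)

text \<open>
  A tuple of functions is encoded as one function of an index and a point, so that the results on
  operators between function spaces apply to matrices.
\<close>

definition matrix_act :: "nat \<Rightarrow> nat \<Rightarrow> (nat \<Rightarrow> nat \<Rightarrow> 'a) \<Rightarrow> (nat \<times> 'b \<Rightarrow> 'k) \<Rightarrow> nat \<times> 'b \<Rightarrow> 'k" where
  "matrix_act n m A u = (\<lambda>(i, x). if i < n then \<Sum>j<m. act (A i j) (\<lambda>y. u (j, y)) x else 0)"

lemma linear_matrix_act:
  assumes "\<And>i j. i < n \<Longrightarrow> j < m \<Longrightarrow> A i j \<in> carrier R"
  shows "linear_operator (matrix_act n m A)"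
  using assms unfolding linear_operator_def matrix_act_def
  by (auto simp: fun_eq_iff linear_operatorD[OF act_linear] sum.distrib sum_distrib_left)

end

definition unit_vector :: "('a, 'c) ring_scheme \<Rightarrow> nat \<Rightarrow> nat \<Rightarrow> nat \<Rightarrow> 'a" where
  "unit_vector R m j = (\<lambda>i\<in>{..<m}. if i = j then \<one>\<^bsub>R\<^esub> else \<zero>\<^bsub>R\<^esub>)"

definition free_module_hom ::
    "('a, 'c) ring_scheme \<Rightarrow> nat \<Rightarrow> nat \<Rightarrow> ((nat \<Rightarrow> 'a) \<Rightarrow> nat \<Rightarrow> 'a) \<Rightarrow> bool" where
  "free_module_hom R m n h \<longleftrightarrow>
    (let M = free_right_module R m; N = free_right_module R n in
      h \<in> carrier M \<rightarrow> carrier N \<and>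
      (\<forall>x\<in>carrier M. \<forall>y\<in>carrier M. h (x \<oplus>\<^bsub>M\<^esub> y) = h x \<oplus>\<^bsub>N\<^esub> h y) \<and>
      (\<forall>x\<in>carrier M. \<forall>r\<in>carrier R. h (r \<odot>\<^bsub>M\<^esub> x) = r \<odot>\<^bsub>N\<^esub> h x))"

lemma (in function_representation) unit_vector_closed:
  "unit_vector R m j \<in> carrier (free_right_module R m)"
  by (auto simp: unit_vector_def free_right_module_def)

text \<open>
  A homomorphism of free right modules is left multiplication by the matrix whose columns are the
  images of the unit vectors. This is read off after applying the representation, where sums are
  sums in \<open>K\<close>.
\<close>

lemma (in function_representation) act_free_module_hom:
  assumes h: "free_module_hom R m n h"
    and x: "x \<in> carrier (free_right_module R m)" and i: "i < n"
  shows "act (h x i) f y = (\<Sum>j<m. act (h (unit_vector R m j) i) (act (x j) f) y)"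
proof -
  let ?M = "free_right_module R m" and ?N = "free_right_module R n"
  have xc: "x j \<in> carrier R" if "j < m" for j
    using x that by (auto simp: free_right_module_def)
  have hc: "h z i \<in> carrier R" if "z \<in> carrier ?M" for z
    using h that i by (auto simp: free_module_hom_def Let_def free_right_module_def Pi_def PiE_def)
  have h_add: "h (z \<oplus>\<^bsub>?M\<^esub> w) i = h z i \<oplus> h w i" if "z \<in> carrier ?M" "w \<in> carrier ?M" for z w
    using h that i by (simp add: free_module_hom_def Let_def) (simp add: free_right_module_def)
  have h_smult: "h (r \<odot>\<^bsub>?M\<^esub> z) i = h z i \<otimes> r" if "z \<in> carrier ?M" "r \<in> carrier R" for z r
    using h that i by (simp add: free_module_hom_def Let_def) (simp add: free_right_module_def)
  \<comment> \<open>The argument is built up one coordinate at a time.\<close>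
  define c where "c k = (\<lambda>j\<in>{..<m}. if j < k then x j else \<zero>)" for k
  have cc: "c k \<in> carrier ?M" for k
    using xc by (auto simp: c_def free_right_module_def)
  have "act (h (c k) i) f y = (\<Sum>j<k. act (h (unit_vector R m j) i) (act (x j) f) y)" if "k \<le> m" for k
    using that
  proof (induction k)
    case 0
    have "c 0 \<oplus>\<^bsub>?M\<^esub> c 0 = c 0" by (auto simp: c_def free_right_module_def)
    then have "h (c 0) i = h (c 0) i \<oplus> h (c 0) i" using h_add[OF cc cc, of 0 0] by simp
    then have "act (h (c 0) i) f y = act (h (c 0) i) f y + act (h (c 0) i) f y"
      using act_add[OF hc[OF cc] hc[OF cc]] by metis
    then have "act (h (c 0) i) f y = 0" by (metis add_cancel_left_left)
    then show ?case by simp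
  next
    case (Suc k)
    let ?e = "unit_vector R m k"
    have e: "x k \<odot>\<^bsub>?M\<^esub> ?e \<in> carrier ?M"
      using xc[of k] Suc.prems unit_vector_closed[of m k] by (auto simp: free_right_module_def)
    have "c (Suc k) = c k \<oplus>\<^bsub>?M\<^esub> (x k \<odot>\<^bsub>?M\<^esub> ?e)"
      using xc Suc.prems
      by (auto simp: c_def free_right_module_def unit_vector_def restrict_def fun_eq_iff less_Suc_eq)
    then have "h (c (Suc k)) i = h (c k) i \<oplus> (h ?e i \<otimes> x k)"
      using h_add[OF cc e] h_smult[OF unit_vector_closed xc] Suc.prems by simp
    then show ?case
      using Suc xc[of k] hc[OF cc, of k] hc[OF unit_vector_closed, of k]
      by (simp add: act_add act_mult)
  qed
  moreover have "c m = x"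
    using x by (auto simp: c_def free_right_module_def restrict_def fun_eq_iff PiE_def extensional_def)
  ultimately show ?thesis by auto
qed

text \<open>
  The inverse of a linear bijection is linear, so both directions of an isomorphism have matrices.
\<close>

lemma right_module_isomorphic_free_inverse_homs:
  assumes "ring R" "right_module_isomorphic R (free_right_module R m) (free_right_module R n)"
  obtains h h' where "free_module_hom R m n h" "free_module_hom R n m h'"
    "\<And>x. x \<in> carrier (free_right_module R m) \<Longrightarrow> h' (h x) = x"
    "\<And>y. y \<in> carrier (free_right_module R n) \<Longrightarrow> h (h' y) = y"
proof -
  interpret ring R by fact
  let ?M = "free_right_module R m" and ?N = "free_right_module R n"
  obtain h where h: "bij_betw h (carrier ?M) (carrier ?N)"
    "\<And>x y. x \<in> carrier ?M \<Longrightarrow> y \<in> carrier ?M \<Longrightarrow> h (x \<oplus>\<^bsub>?M\<^esub> y) = h x \<oplus>\<^bsub>?N\<^esub> h y"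
    "\<And>x r. x \<in> carrier ?M \<Longrightarrow> r \<in> carrier R \<Longrightarrow> h (r \<odot>\<^bsub>?M\<^esub> x) = r \<odot>\<^bsub>?N\<^esub> h x"
    using assms(2) by (auto simp: right_module_isomorphic_def)
  define h' where "h' = inv_into (carrier ?M) h"
  have h'h: "h' (h x) = x" if "x \<in> carrier ?M" for x
    using h(1) that by (simp add: h'_def bij_betw_inv_into_left)
  have hh': "h (h' y) = y" if "y \<in> carrier ?N" for y
    using h(1) that by (simp add: h'_def bij_betw_inv_into_right)
  have hc: "h x \<in> carrier ?N" if "x \<in> carrier ?M" for x
    using h(1) that by (auto simp: bij_betw_def)
  have h'c: "h' y \<in> carrier ?M" if "y \<in> carrier ?N" for y
    using h(1) that by (metis bij_betw_def h'_def inv_into_into)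
  have Mc: "x \<oplus>\<^bsub>?M\<^esub> y \<in> carrier ?M" "r \<odot>\<^bsub>?M\<^esub> x \<in> carrier ?M"
    if "x \<in> carrier ?M" "y \<in> carrier ?M" "r \<in> carrier R" for x y r
    using that by (auto simp: free_right_module_def)
  have "free_module_hom R m n h"
    using h hc by (auto simp: free_module_hom_def Let_def)
  moreover have "free_module_hom R n m h'"
    unfolding free_module_hom_def Let_def
  proof (intro conjI ballI Pi_I)
    fix x y assume "x \<in> carrier ?N" "y \<in> carrier ?N"
    then have "h (h' x \<oplus>\<^bsub>?M\<^esub> h' y) = x \<oplus>\<^bsub>?N\<^esub> y"
      by (simp add: h h'c hh')
    then show "h' (x \<oplus>\<^bsub>?N\<^esub> y) = h' x \<oplus>\<^bsub>?M\<^esub> h' y"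
      using h'h Mc(1) h'c \<open>x \<in> _\<close> \<open>y \<in> _\<close> zero_closed by metis
  next
    fix x r assume "x \<in> carrier ?N" "r \<in> carrier R"
    then have "h (r \<odot>\<^bsub>?M\<^esub> h' x) = r \<odot>\<^bsub>?N\<^esub> x"
      by (simp add: h h'c hh')
    then show "h' (r \<odot>\<^bsub>?N\<^esub> x) = r \<odot>\<^bsub>?M\<^esub> h' x"
      using h'h Mc(2) h'c \<open>x \<in> _\<close> \<open>r \<in> _\<close> by metis
  qed (rule h'c)
  ultimately show ?thesis using that h'h hh' by blast
qed

text \<open>
  The operators of mutually inverse matrices compose to the operator of the identity matrix. For a
  representation in which \<open>1\<close> acts as the restriction to \<open>B\<close>, this is restriction to \<open>B\<close> in each
  component.
\<close>

lemma (in function_representation) matrix_act_inverse: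
  assumes h: "free_module_hom R m n h" and h': "free_module_hom R n m h'"
    and hh': "\<And>y. y \<in> carrier (free_right_module R n) \<Longrightarrow> h (h' y) = y"
    and one: "\<And>f x. act \<one> f x = (if x \<in> B then f x else 0)"
  shows "matrix_act n m (\<lambda>i j. h (unit_vector R m j) i)
           (matrix_act m n (\<lambda>i j. h' (unit_vector R n j) i) v) t =
         (if t \<in> {..<n} \<times> B then v t else 0)"
proof -
  obtain i x where t: "t = (i, x)" by (cases t)
  have c: "h (unit_vector R m j) i \<in> carrier R" if "i < n" for i j
    using h that unit_vector_closed[of m j]
    by (auto simp: free_module_hom_def Let_def free_right_module_def Pi_def PiE_def)
  have c': "h' (unit_vector R n j) \<in> carrier (free_right_module R m)" for j
    using h' unit_vector_closed[of n j] by (auto simp: free_module_hom_def Let_def)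
  have "(\<Sum>j<m. act (h (unit_vector R m j) i)
          (\<lambda>y. \<Sum>k<n. act (h' (unit_vector R n k) j) (\<lambda>z. v (k, z)) y) x) =
        (if x \<in> B then v (i, x) else 0)" if i: "i < n"
  proof -
    have "(\<Sum>j<m. act (h (unit_vector R m j) i)
            (\<lambda>y. \<Sum>k<n. act (h' (unit_vector R n k) j) (\<lambda>z. v (k, z)) y) x) =
          (\<Sum>j<m. \<Sum>k<n. act (h (unit_vector R m j) i)
            (act (h' (unit_vector R n k) j) (\<lambda>z. v (k, z))) x)"
      using c i by (simp add: linear_operator_sum[OF act_linear])
    also have "\<dots> = (\<Sum>k<n. \<Sum>j<m. act (h (unit_vector R m j) i)
            (act (h' (unit_vector R n k) j) (\<lambda>z. v (k, z))) x)"
      by (rule sum.swap)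
    also have "\<dots> = (\<Sum>k<n. act (h (h' (unit_vector R n k)) i) (\<lambda>z. v (k, z)) x)"
      using act_free_module_hom[OF h c' i] by simp
    also have "\<dots> = (\<Sum>k<n. act (unit_vector R n k i) (\<lambda>z. v (k, z)) x)"
      by (simp add: hh'[OF unit_vector_closed])
    also have "\<dots> = (\<Sum>k<n. if i = k then act \<one> (\<lambda>z. v (k, z)) x else 0)"
      using i by (intro sum.cong) (auto simp: act_zero unit_vector_def)
    finally show ?thesis using i by (simp add: one)
  qed
  then show ?thesis by (auto simp: t matrix_act_def)
qed

text \<open>
  The index criterion. With \<open>A\<close> and \<open>A'\<close> the matrices of an isomorphism and its inverse, the
  operators \<open>\<rho>(A)\<close>, \<open>\<rho>(A')\<close> are inverse to each other on functions on \<open>B\<close>, and \<open>\<sigma>(A)\<close>,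
  \<open>\<sigma>(A')\<close> on functions on \<open>B - Z\<close>. The defect of \<open>\<sigma>\<close> is thus \<open>m |Z|\<close> on one side and
  \<open>n |Z|\<close> on the other, and the comparison with \<open>\<rho>\<close> shows that the first is at most the second.
  Exchanging the roles of \<open>m\<close> and \<open>n\<close> gives equality.
\<close>

lemma free_ranks_eq_of_finite_difference:
  fixes \<rho> \<sigma> :: "'a \<Rightarrow> ('b \<Rightarrow> 'k::field) \<Rightarrow> 'b \<Rightarrow> 'k"
  assumes rep: "function_representation R \<rho>" "function_representation R \<sigma>"
    and one: "\<And>f x. \<rho> \<one>\<^bsub>R\<^esub> f x = (if x \<in> B then f x else 0)"
      "\<And>f x. \<sigma> \<one>\<^bsub>R\<^esub> f x = (if x \<in> B - Z then f x else 0)"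
    and Z: "finite Z" "Z \<noteq> {}" "Z \<subseteq> B"
    and diff: "\<And>a. a \<in> carrier R \<Longrightarrow> finite {x. \<exists>f. \<rho> a f x \<noteq> \<sigma> a f x}"
    and iso: "right_module_isomorphic R (free_right_module R m) (free_right_module R n)"
  shows "m = n"
proof -
  interpret \<rho>: function_representation R \<rho> by fact
  interpret \<sigma>: function_representation R \<sigma> by fact
  have le: "m \<le> n"
    if h: "free_module_hom R m n h" and h': "free_module_hom R n m h'"
      and h'h: "\<And>x. x \<in> carrier (free_right_module R m) \<Longrightarrow> h' (h x) = x"
      and hh': "\<And>y. y \<in> carrier (free_right_module R n) \<Longrightarrow> h (h' y) = y" for m n h h'
  proof -
    define A where "A i j = h (unit_vector R m j) i" for i j
    define A' where "A' i j = h' (unit_vector R n j) i" for i j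
    have A: "A i j \<in> carrier R" if "i < n" for i j
      using h that \<rho>.unit_vector_closed[of m j] unfolding A_def
      by (auto simp: free_module_hom_def Let_def free_right_module_def Pi_def PiE_def)
    have A': "A' i j \<in> carrier R" if "i < m" for i j
      using h' that \<rho>.unit_vector_closed[of n j] unfolding A'_def
      by (auto simp: free_module_hom_def Let_def free_right_module_def Pi_def PiE_def)
    \<comment> \<open>As \<open>a = 1 a\<close>, all operators take values in the range of the operator of \<open>1\<close>.\<close>
    have out: "\<rho> a f x = 0" if "a \<in> carrier R" "x \<notin> B" for a f x
      using \<rho>.act_mult[of "\<one>\<^bsub>R\<^esub>" a f] that one(1)[of "\<rho> a f" x] by simp
    have out': "\<sigma> a f x = 0" if "a \<in> carrier R" "x \<notin> B - Z" for a f x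
      using \<sigma>.act_mult[of "\<one>\<^bsub>R\<^esub>" a f] that one(2)[of "\<sigma> a f" x] by auto
    define D where "D = (\<Union>i<m. \<Union>j<n. {i} \<times> {x. \<exists>f. \<rho> (A' i j) f x \<noteq> \<sigma> (A' i j) f x})"
    have "card ({..<m} \<times> Z) \<le> card ({..<n} \<times> Z)"
    proof (rule finite_perturbation_defect_le[where
          X = "\<rho>.matrix_act n m A" and X' = "\<rho>.matrix_act m n A'" and
          Y = "\<sigma>.matrix_act n m A" and Y' = "\<sigma>.matrix_act m n A'" and
          M = "{..<m} \<times> B" and N = "{..<n} \<times> B" and D = D])
      show "linear_operator (\<rho>.matrix_act n m A)" "linear_operator (\<sigma>.matrix_act n m A)"
        "linear_operator (\<sigma>.matrix_act m n A')"
        by (auto intro: \<rho>.linear_matrix_act \<sigma>.linear_matrix_act A A')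
      show "finite ({..<m} \<times> Z)" "{..<m} \<times> Z \<subseteq> {..<m} \<times> B" "finite ({..<n} \<times> Z)"
        using Z by auto
      show "\<rho>.matrix_act n m A u t = 0" if "t \<notin> {..<n} \<times> B" for u t
        using that by (cases t) (auto simp: \<rho>.matrix_act_def out A)
      show "\<sigma>.matrix_act m n A' v s = 0" if "s \<notin> {..<m} \<times> B - {..<m} \<times> Z" for v s
        using that by (cases s) (auto simp: \<sigma>.matrix_act_def out' A')
      show "\<rho>.matrix_act m n A' (\<rho>.matrix_act n m A u) s = (if s \<in> {..<m} \<times> B then u s else 0)" for u s
        unfolding A_def A'_def by (rule \<rho>.matrix_act_inverse[OF h' h h'h one(1)])
      show "\<sigma>.matrix_act n m A (\<sigma>.matrix_act m n A' v) t =
          (if t \<in> {..<n} \<times> B - {..<n} \<times> Z then v t else 0)" for v t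
        using \<sigma>.matrix_act_inverse[OF h h' hh' one(2), of v t]
        unfolding A_def A'_def by (auto split: if_splits)
      show "finite D" unfolding D_def using diff A' by auto
      show "\<rho>.matrix_act m n A' v s = \<sigma>.matrix_act m n A' v s" if "s \<notin> D" for v s
        using that by (cases s) (auto simp: \<rho>.matrix_act_def \<sigma>.matrix_act_def D_def intro!: sum.cong)
    qed
    moreover have "card Z > 0" using Z by (simp add: card_gt_0_iff)
    ultimately show ?thesis by (simp add: card_cartesian_product)
  qed
  obtain h h' where "free_module_hom R m n h" "free_module_hom R n m h'"
    "\<And>x. x \<in> carrier (free_right_module R m) \<Longrightarrow> h' (h x) = x"
    "\<And>y. y \<in> carrier (free_right_module R n) \<Longrightarrow> h (h' y) = y"
    using right_module_isomorphic_free_inverse_homs[OF \<rho>.ring_axioms iso] by blast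
  then show ?thesis using le by (metis le_antisym)
qed

section \<open>Words acting through partial maps\<close>

fun run :: "('g \<Rightarrow> 'b \<Rightarrow> 'b option) \<Rightarrow> 'g list \<Rightarrow> 'b \<Rightarrow> 'b option" where
  "run \<theta> [] x = Some x"
| "run \<theta> (g # gs) x = Option.bind (\<theta> g x) (run \<theta> gs)"

lemma run_Nil: "run \<theta> [] = Some"
  by (simp add: fun_eq_iff)

lemma run_append: "run \<theta> (gs @ hs) x = Option.bind (run \<theta> gs x) (run \<theta> hs)"
proof (induction gs arbitrary: x)
  case (Cons g gs)
  then show ?case by (cases "\<theta> g x") simp_all
qed simp

definition pull :: "('b \<Rightarrow> 'k::field) \<Rightarrow> 'b option \<Rightarrow> 'k" where
  "pull f y = (case y of None \<Rightarrow> 0 | Some z \<Rightarrow> f z)"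

lemma pull_simps [simp]: "pull f None = 0" "pull f (Some z) = f z"
  by (simp_all add: pull_def)

lemma pull_add: "pull (\<lambda>x. f x + g x) y = pull f y + pull g y"
  and pull_scale: "pull (\<lambda>x. c * f x) y = c * pull f y"
  by (simp_all add: pull_def split: option.splits)

text \<open>
  The linear extension to the free algebra of the action of words on functions by pull-back.
  Pull-back is contravariant, so reading a word from left to right in \<open>run\<close> makes this a left
  action.
\<close>

definition word_operator ::
    "('g \<Rightarrow> 'b \<Rightarrow> 'b option) \<Rightarrow> ('g word \<Rightarrow>\<^sub>0 'k::field) \<Rightarrow> ('b \<Rightarrow> 'k) \<Rightarrow> 'b \<Rightarrow> 'k" where
  "word_operator \<theta> p f x =
    (\<Sum>w\<in>Poly_Mapping.keys p. Poly_Mapping.lookup p w * pull f (run \<theta> (letters w) x))"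

lemma word_operator_superset:
  assumes "finite W" "Poly_Mapping.keys p \<subseteq> W"
  shows "word_operator \<theta> p f x =
    (\<Sum>w\<in>W. Poly_Mapping.lookup p w * pull f (run \<theta> (letters w) x))"
  unfolding word_operator_def
  using assms by (intro sum.mono_neutral_left) (auto simp: in_keys_iff)

lemma linear_word_operator: "linear_operator (word_operator \<theta> p)"
  by (simp add: linear_operator_def word_operator_def fun_eq_iff pull_add pull_scale algebra_simps
      sum.distrib sum_distrib_left)

lemma word_operator_zero [simp]: "word_operator \<theta> 0 f x = 0"
  by (simp add: word_operator_def)

lemma word_operator_single:
  "word_operator \<theta> (Poly_Mapping.single w c) f x = c * pull f (run \<theta> (letters w) x)"
  by (simp add: word_operator_def)

lemma word_operator_add:
  "word_operator \<theta> (p + q) f x = word_operator \<theta> p f x + word_operator \<theta> q f x"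
proof -
  let ?W = "Poly_Mapping.keys p \<union> Poly_Mapping.keys q"
  have "word_operator \<theta> r f x =
      (\<Sum>w\<in>?W. Poly_Mapping.lookup r w * pull f (run \<theta> (letters w) x))"
    if "r \<in> {p, q, p + q}" for r
    using that keys_add[of p q] by (intro word_operator_superset) auto
  then show ?thesis by (simp add: lookup_add algebra_simps sum.distrib)
qed

lemma word_operator_uminus: "word_operator \<theta> (- p) f x = - word_operator \<theta> p f x"
  by (simp add: word_operator_def sum_negf)

lemma word_operator_diff:
  "word_operator \<theta> (p - q) f x = word_operator \<theta> p f x - word_operator \<theta> q f x"
  using word_operator_add[of \<theta> p "- q" f x] by (simp add: word_operator_uminus)

lemma word_operator_sum:
  "word_operator \<theta> (\<Sum>i\<in>I. p i) f x = (\<Sum>i\<in>I. word_operator \<theta> (p i) f x)"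
  by (induction I rule: infinite_finite_induct) (simp_all add: word_operator_add)

lemma poly_mapping_as_sum:
  "p = (\<Sum>w\<in>Poly_Mapping.keys p. Poly_Mapping.single w (Poly_Mapping.lookup p w))"
  by (rule poly_mapping_eqI) (auto simp: lookup_sum lookup_single when_def in_keys_iff)

text \<open>
  By bilinearity it suffices to multiply two monomials, where it is \<open>run_append\<close>.
\<close>

lemma word_operator_mult:
  fixes p q :: "'a word \<Rightarrow>\<^sub>0 'k::field"
  shows "word_operator \<theta> (p * q) f x = word_operator \<theta> p (word_operator \<theta> q f) x"
proof -
  have single: "word_operator \<theta> (Poly_Mapping.single v c * Poly_Mapping.single w d) f x =
      word_operator \<theta> (Poly_Mapping.single v c) (word_operator \<theta> (Poly_Mapping.single w d) f) x"
    for v w c d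
    by (cases "run \<theta> (letters v) x")
      (simp_all add: mult_single word_operator_single plus_word_def run_append)
  define s where "s r w = Poly_Mapping.single w (Poly_Mapping.lookup r w)" for r :: "'a word \<Rightarrow>\<^sub>0 'k" and w
  have s: "(\<Sum>w\<in>Poly_Mapping.keys r. s r w) = r" for r
    unfolding s_def by (rule poly_mapping_as_sum[symmetric])
  have inner: "word_operator \<theta> (\<Sum>w\<in>Poly_Mapping.keys q. s q w) f =
      (\<lambda>y. \<Sum>w\<in>Poly_Mapping.keys q. word_operator \<theta> (s q w) f y)"
    by (simp add: word_operator_sum fun_eq_iff)
  have "word_operator \<theta> (p * q) f x =
      word_operator \<theta> ((\<Sum>v\<in>Poly_Mapping.keys p. s p v) * (\<Sum>w\<in>Poly_Mapping.keys q. s q w)) f x"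
    by (simp only: s)
  also have "\<dots> = (\<Sum>v\<in>Poly_Mapping.keys p. \<Sum>w\<in>Poly_Mapping.keys q.
      word_operator \<theta> (s p v) (word_operator \<theta> (s q w) f) x)"
    by (simp add: sum_product word_operator_sum s_def single)
  also have "\<dots> = (\<Sum>v\<in>Poly_Mapping.keys p. word_operator \<theta> (s p v)
      (\<lambda>y. \<Sum>w\<in>Poly_Mapping.keys q. word_operator \<theta> (s q w) f y) x)"
    by (simp add: linear_operator_sum[OF linear_word_operator])
  also have "\<dots> = word_operator \<theta> (\<Sum>v\<in>Poly_Mapping.keys p. s p v)
      (word_operator \<theta> (\<Sum>w\<in>Poly_Mapping.keys q. s q w) f) x"
    by (simp only: word_operator_sum inner)
  also have "\<dots> = word_operator \<theta> p (word_operator \<theta> q f) x"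
    by (simp only: s)
  finally show ?thesis .
qed

lemma word_operator_gen: "word_operator \<theta> (gen g) f x = pull f (\<theta> g x)"
  by (simp add: gen_def word_operator_single run_Nil)

lemma word_operator_gen_mult:
  "word_operator \<theta> (gen g * gen h) f x = pull f (Option.bind (\<theta> g x) (\<theta> h))"
  by (cases "\<theta> g x") (simp_all add: word_operator_mult word_operator_gen)


section \<open>Avoiding a finite set of states\<close>

definition avoid :: "'b set \<Rightarrow> ('g \<Rightarrow> 'b \<Rightarrow> 'b option) \<Rightarrow> 'g \<Rightarrow> 'b \<Rightarrow> 'b option" where
  "avoid Z \<theta> g x = (case \<theta> g x of None \<Rightarrow> None | Some y \<Rightarrow> if x \<in> Z \<or> y \<in> Z then None else Some y)"

text \<open>
  The two runs of a word differ only if the unrestricted one visits \<open>Z\<close>. For each step, the start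
  states that lead into the finite set \<open>Z\<close> at that step form a preimage under an injective partial
  map.
\<close>

lemma finite_run_avoid_neq:
  assumes "finite Z"
    and inj: "\<And>g x y z. \<lbrakk>g \<in> set gs; \<theta> g x = Some z; \<theta> g y = Some z\<rbrakk> \<Longrightarrow> x = y"
  shows "finite {x. run \<theta> gs x \<noteq> run (avoid Z \<theta>) gs x}"
  using inj
proof (induction gs)
  case (Cons g gs)
  let ?D = "{x. run \<theta> gs x \<noteq> run (avoid Z \<theta>) gs x}"
  have pre: "finite {x. \<theta> g x \<in> Some ` Y}" if "finite Y" for Y
  proof (rule finite_imageD)
    show "finite (\<theta> g ` {x. \<theta> g x \<in> Some ` Y})"
      using that by (auto intro: finite_subset[of _ "Some ` Y"])
    show "inj_on (\<theta> g) {x. \<theta> g x \<in> Some ` Y}"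
      using Cons.prems[of g] by (fastforce intro!: inj_onI)
  qed
  have "{x. run \<theta> (g # gs) x \<noteq> run (avoid Z \<theta>) (g # gs) x} \<subseteq>
      Z \<union> {x. \<theta> g x \<in> Some ` (Z \<union> ?D)}"
  proof (intro subsetI UnCI)
    fix x assume x: "x \<in> {x. run \<theta> (g # gs) x \<noteq> run (avoid Z \<theta>) (g # gs) x}"
      "x \<notin> {x. \<theta> g x \<in> Some ` (Z \<union> ?D)}"
    show "x \<in> Z"
    proof (cases "\<theta> g x")
      case (Some y)
      with x show ?thesis by (cases "x \<in> Z") (auto simp: avoid_def)
    qed (use x in \<open>simp add: avoid_def\<close>)
  qed
  moreover have "finite ?D" using Cons by auto
  ultimately show ?case using pre[of "Z \<union> ?D"] assms(1) by (meson finite_Un finite_subset)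
qed simp

lemma finite_word_operator_avoid_neq:
  fixes p :: "'g word \<Rightarrow>\<^sub>0 'k::field"
  assumes "finite Z" "p \<in> carrier (free_algebra A)"
    and "\<And>g x y z. \<lbrakk>g \<in> A; \<theta> g x = Some z; \<theta> g y = Some z\<rbrakk> \<Longrightarrow> x = y"
  shows "finite {x. \<exists>f. word_operator \<theta> p f x \<noteq> word_operator (avoid Z \<theta>) p f x}"
proof (rule finite_subset)
  show "{x. \<exists>f. word_operator \<theta> p f x \<noteq> word_operator (avoid Z \<theta>) p f x} \<subseteq>
      (\<Union>w\<in>Poly_Mapping.keys p. {x. run \<theta> (letters w) x \<noteq> run (avoid Z \<theta>) (letters w) x})"
    unfolding word_operator_def by (auto intro: sum.cong)
  show "finite (\<Union>w\<in>Poly_Mapping.keys p.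
      {x. run \<theta> (letters w) x \<noteq> run (avoid Z \<theta>) (letters w) x})"
    using assms(2,3) unfolding carrier_free_algebra
    by (intro finite_UN_I finite_run_avoid_neq assms(1)) (simp, blast)
qed


section \<open>Representations of the separated Cohn path algebra\<close>

definition cohn_unit :: "('v, 'e) pre_digraph \<Rightarrow> ('v, 'e) cohn_generator word \<Rightarrow>\<^sub>0 'k::field" where
  "cohn_unit G = (\<Sum>v\<in>verts G. gen (Vertex v))"

text \<open>
  The choice of representative is harmless once the action kills the ideal of which \<open>c\<close> is a
  coset.
\<close>

definition coset_operator ::
    "('g \<Rightarrow> 'b \<Rightarrow> 'b option) \<Rightarrow> ('g word \<Rightarrow>\<^sub>0 'k::field) set \<Rightarrow> ('b \<Rightarrow> 'k) \<Rightarrow> 'b \<Rightarrow> 'k" where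
  "coset_operator \<theta> c = word_operator \<theta> (SOME p. p \<in> c)"

text \<open>
  As the kernel is an ideal, an action of the free algebra descends to the algebra presented by
  any relations that it satisfies.
\<close>

lemma ideal_word_operator_kernel:
  "ideal {p \<in> carrier (free_algebra A). \<forall>f x. word_operator \<theta> p f x = (0 :: 'k::field)}
     (free_algebra A)"
proof -
  interpret F: ring "free_algebra A :: ('a word \<Rightarrow>\<^sub>0 'k) ring" by (rule ring_free_algebra)
  let ?K = "{p \<in> carrier (free_algebra A). \<forall>f x. word_operator \<theta> p f x = (0 :: 'k)}"
  have inv: "\<ominus>\<^bsub>free_algebra A\<^esub> p = - p" if "p \<in> carrier (free_algebra A)" for p :: "'a word \<Rightarrow>\<^sub>0 'k"
    using that by (intro F.minus_equality) (auto simp: free_algebra_closed)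
  show ?thesis
  proof (rule idealI[OF ring_free_algebra])
    show "subgroup ?K (add_monoid (free_algebra A))"
    proof (rule F.add.subgroupI)
      fix a assume "a \<in> ?K"
      then show "\<ominus>\<^bsub>free_algebra A\<^esub> a \<in> ?K"
        using free_algebra_closed[of a A a] by (simp add: inv word_operator_uminus)
    qed (auto simp: free_algebra_closed word_operator_add intro: exI[of _ 0])
  next
    fix a x :: "'a word \<Rightarrow>\<^sub>0 'k" assume "a \<in> ?K" "x \<in> carrier (free_algebra A)"
    moreover from this have "word_operator \<theta> a f = (\<lambda>y. 0)" for f by auto
    ultimately show "x \<otimes>\<^bsub>free_algebra A\<^esub> a \<in> ?K" "a \<otimes>\<^bsub>free_algebra A\<^esub> x \<in> ?K"
      by (auto simp: free_algebra_closed word_operator_mult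
          linear_operator_zero[OF linear_word_operator])
  qed
qed

text \<open>
  Any action of the generators that satisfies the Cohn relations gives a representation of the
  separated Cohn path algebra. The other conclusions describe the algebra by representatives, for
  use in computations with this representation.
\<close>

lemma separated_cohn_path_algebra_coset_operator:
  fixes G :: "('v, 'e) pre_digraph" and \<theta> :: "('v, 'e) cohn_generator \<Rightarrow> 'b \<Rightarrow> 'b option"
  assumes G: "fin_digraph G" "separated_graph G P"
    and rel: "\<forall>p\<in>cohn_relations G P. \<forall>f x. word_operator \<theta> p f x = (0 :: 'k::field)"
  defines "R \<equiv> separated_cohn_path_algebra G P :: (('v, 'e) cohn_generator word \<Rightarrow>\<^sub>0 'k) set ring"
    and "\<pi> \<equiv> \<lambda>p. cohn_ideal G P +>\<^bsub>free_algebra (cohn_generators G)\<^esub> p"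
    and "act \<equiv> coset_operator \<theta>"
  shows "function_representation R act"
    and "carrier R = \<pi> ` augmentation_ideal (cohn_generators G)"
    and "\<one>\<^bsub>R\<^esub> = \<pi> (cohn_unit G)"
    and "p \<in> carrier (free_algebra (cohn_generators G)) \<Longrightarrow> act (\<pi> p) = word_operator \<theta> p"
proof -
  define A where "A = cohn_generators G"
  define F :: "(('v, 'e) cohn_generator word \<Rightarrow>\<^sub>0 'k) ring" where "F = free_algebra A"
  define C :: "(('v, 'e) cohn_generator word \<Rightarrow>\<^sub>0 'k) set" where "C = augmentation_ideal A"
  define I :: "(('v, 'e) cohn_generator word \<Rightarrow>\<^sub>0 'k) set" where "I = cohn_ideal G P"
  define K where "K = {p \<in> carrier F. \<forall>f x. word_operator \<theta> p f x = 0}"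
  interpret F: ring F unfolding F_def by (rule ring_free_algebra)
  have CF: "C \<subseteq> carrier F" by (auto simp: C_def F_def augmentation_ideal_def)
  have S: "cohn_relations G P \<subseteq> C"
    using cohn_relations_subset[OF G(2)] by (simp add: C_def A_def)
  have I_eq: "I = Idl\<^bsub>F\<^esub> (cohn_relations G P)" by (simp add: I_def cohn_ideal_def F_def A_def)
  interpret I: ideal I F unfolding I_eq using S CF by (intro F.genideal_ideal) auto
  have "ideal K F" unfolding K_def F_def by (rule ideal_word_operator_kernel)
  then have IK: "I \<subseteq> K"
    unfolding I_eq using S CF rel by (intro F.genideal_minimal) (auto simp: K_def)
  have \<pi>: "\<pi> = (\<lambda>p. I +>\<^bsub>F\<^esub> p)" by (simp add: \<pi>_def I_def F_def A_def)
  show act: "act (\<pi> p) = word_operator \<theta> p" if "p \<in> carrier (free_algebra (cohn_generators G))" for p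
  proof -
    have p: "p \<in> carrier F" using that by (simp add: F_def A_def)
    define q where "q = (SOME q. q \<in> \<pi> p)"
    have "p \<in> \<pi> p" using I.a_rcos_self p by (simp add: \<pi>)
    then have "q \<in> \<pi> p" unfolding q_def by (rule someI)
    then obtain i where "i \<in> I" "q = i + p" by (auto simp: \<pi> a_r_coset_def' F_def)
    then have "word_operator \<theta> q = word_operator \<theta> p"
      using IK by (auto simp: K_def word_operator_add fun_eq_iff)
    then show ?thesis by (simp add: act_def coset_operator_def q_def)
  qed
  have R: "R = (F Quot I) \<lparr>carrier := \<pi> ` C, one := \<pi> (cohn_unit G)\<rparr>"
    unfolding R_def separated_cohn_path_algebra_def Let_def \<pi>
    by (simp add: I_def F_def C_def A_def cohn_unit_def)
  then show carrier: "carrier R = \<pi> ` augmentation_ideal (cohn_generators G)"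
    and "\<one>\<^bsub>R\<^esub> = \<pi> (cohn_unit G)"
    by (simp_all add: C_def A_def)
  have add: "\<pi> p \<oplus>\<^bsub>R\<^esub> \<pi> q = \<pi> (p + q)" and mult: "\<pi> p \<otimes>\<^bsub>R\<^esub> \<pi> q = \<pi> (p * q)"
    if "p \<in> carrier F" "q \<in> carrier F" for p q
    using I.a_rcos_sum[OF that] I.rcoset_mult_add[OF that]
    by (simp_all add: R \<pi> FactRing_def) (simp_all add: F_def)
  have act': "act (\<pi> p) = word_operator \<theta> p" if "p \<in> carrier F" for p
    using act that by (simp add: F_def A_def)
  have closed: "p + q \<in> carrier F" "p * q \<in> carrier F" if "p \<in> carrier F" "q \<in> carrier F" for p q
    using that by (simp_all add: F_def free_algebra_closed)
  have repr: "\<exists>p \<in> carrier F. c = \<pi> p" if "c \<in> carrier R" for c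
    using that CF by (auto simp: carrier C_def A_def)
  have ringR: "ring R" unfolding R_def by (rule ring_separated_cohn_path_algebra[OF G])
  show "function_representation R act"
  proof (intro function_representation.intro function_representation_axioms.intro ringR)
    fix a assume "a \<in> carrier R"
    then show "linear_operator (act a)"
      using repr[of a] by (auto simp: act' linear_word_operator)
  next
    fix a b f x assume "a \<in> carrier R" "b \<in> carrier R"
    then obtain p q where pq: "p \<in> carrier F" "q \<in> carrier F" "a = \<pi> p" "b = \<pi> q"
      using repr by metis
    then show "act (a \<oplus>\<^bsub>R\<^esub> b) f x = act a f x + act b f x" "act (a \<otimes>\<^bsub>R\<^esub> b) f = act a (act b f)"
      by (simp_all add: add mult act' closed word_operator_add word_operator_mult fun_eq_iff)
  qed
qed


section \<open>The two representations\<close>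

text \<open>
  Lists need not be paths in the graph, and any vertex may be paired with any list. Since the
  list records which edge was traversed, distinct edges have disjoint images under \<open>Ghost\<close>;
  thus \<open>e\<^sup>* f = 0\<close> holds for all \<open>e \<noteq> f\<close>, which contains the Cohn relations of every block.
\<close>

fun path_step :: "('v, 'e) pre_digraph \<Rightarrow> ('v, 'e) cohn_generator \<Rightarrow> 'v \<times> 'e list \<Rightarrow> ('v \<times> 'e list) option" where
  "path_step G (Vertex u) (v, es) = (if v = u then Some (v, es) else None)"
| "path_step G (Edge e) (v, es) =
    (case es of [] \<Rightarrow> None | d # ds \<Rightarrow> if d = e \<and> v = tail G e then Some (head G e, ds) else None)"
| "path_step G (Ghost e) (v, es) = (if v = head G e then Some (tail G e, e # es) else None)"

lemma path_step_inj:
  assumes "path_step G g x = Some z" "path_step G g y = Some z"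
  shows "x = y"
  using assms
  by (cases g; cases x; cases y) (auto split: if_splits list.splits)

text \<open>
  The Cohn relations survive the removal of the states \<open>(v, [])\<close>: the intermediate state in the
  left-hand side of a relation is its first state or its last one, or, in \<open>e\<^sup>* f\<close>, has a nonempty
  list. So forbidding states removes the same starting points from both sides.
\<close>

lemma path_step_relations:
  assumes "p \<in> cohn_relations G P"
    and Z: "Z \<subseteq> UNIV \<times> {[]}"
  shows "word_operator (avoid Z (path_step G)) p f x = (0 :: 'k::field)"
proof -
  obtain v es where x: "x = (v, es)" by (cases x)
  let ?\<theta> = "avoid Z (path_step G)"
  have ne: "(u, d # ds) \<notin> Z" for u d ds using Z by auto
  have vertex: "?\<theta> (Vertex u) (w, ds) = (if w = u \<and> (w, ds) \<notin> Z then Some (w, ds) else None)"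
    for u w ds by (simp add: avoid_def)
  have edge: "?\<theta> (Edge e) (w, []) = None"
    "?\<theta> (Edge e) (w, d # ds) =
      (if d = e \<and> w = tail G e \<and> (head G e, ds) \<notin> Z then Some (head G e, ds) else None)"
    for e w d ds by (simp_all add: avoid_def ne)
  have ghost: "?\<theta> (Ghost e) (w, ds) =
      (if w = head G e \<and> (w, ds) \<notin> Z then Some (tail G e, e # ds) else None)"
    for e w ds by (simp add: avoid_def ne)
  note step = word_operator_diff word_operator_gen_mult word_operator_gen vertex edge ghost ne
  from assms(1) show ?thesis
    unfolding cohn_relations_def
  proof (elim UnE CollectE exE conjE)
    fix u w assume "p = gen (Vertex u) * gen (Vertex w) - (if u = w then gen (Vertex u) else 0)"
    then show ?thesis by (auto simp: x step)
  next
    fix e assume "p = gen (Vertex (tail G e)) * gen (Edge e) - gen (Edge e)"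
    then show ?thesis by (cases es) (auto simp: x step)
  next
    fix e assume "p = gen (Edge e) * gen (Vertex (head G e)) - gen (Edge e)"
    then show ?thesis by (cases es) (auto simp: x step)
  next
    fix e assume "p = gen (Vertex (head G e)) * gen (Ghost e) - gen (Ghost e)"
    then show ?thesis by (auto simp: x step)
  next
    fix e assume "p = gen (Ghost e) * gen (Vertex (tail G e)) - gen (Ghost e)"
    then show ?thesis by (auto simp: x step)
  next
    fix e d assume "p = gen (Ghost e) * gen (Edge d) - (if e = d then gen (Vertex (head G e)) else 0)"
    then show ?thesis by (cases "e = d"; cases "v = head G e"; cases "(v, es) \<in> Z") (simp_all add: x step)
  qed
qed

lemma avoid_empty [simp]: "avoid {} \<theta> = \<theta>"
  by (auto simp: avoid_def fun_eq_iff split: option.splits)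

lemma word_operator_cohn_unit:
  assumes "finite (verts G)"
  shows "word_operator (avoid Z (path_step G)) (cohn_unit G) f x =
    (if x \<in> verts G \<times> UNIV - Z then f x else (0 :: 'k::field))"
proof -
  obtain v es where x: "x = (v, es)" by (cases x)
  have "word_operator (avoid Z (path_step G)) (cohn_unit G) f x =
      (\<Sum>u\<in>verts G. if v = u then (if x \<in> Z then 0 else f x) else 0)"
    unfolding cohn_unit_def word_operator_sum
    by (intro sum.cong) (auto simp: word_operator_gen avoid_def x)
  then show ?thesis using assms by (simp add: x)
qed

theorem corollary14:
  fixes G :: "('v, 'e) pre_digraph" and P :: "'e set set"
  assumes "fin_digraph G"
    and "verts G \<noteq> {}"
    and "separated_graph G P"
  shows "has_IBN (separated_cohn_path_algebra G P ::
           (('v, 'e) cohn_generator word \<Rightarrow>\<^sub>0 'k::field) set ring)"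
proof -
  interpret fin_digraph G by fact
  let ?R = "separated_cohn_path_algebra G P :: (('v, 'e) cohn_generator word \<Rightarrow>\<^sub>0 'k) set ring"
  define Z :: "('v \<times> 'e list) set" where "Z = verts G \<times> {[]}"
  define \<theta> where "\<theta> = path_step G"
  have Z: "finite Z" "Z \<noteq> {}" "Z \<subseteq> verts G \<times> UNIV" using assms(2) by (auto simp: Z_def)
  have rel: "\<forall>p\<in>cohn_relations G P. \<forall>f x. word_operator \<theta> p f x = (0 :: 'k)"
    "\<forall>p\<in>cohn_relations G P. \<forall>f x. word_operator (avoid Z \<theta>) p f x = (0 :: 'k)"
    unfolding \<theta>_def Z_def
    by (intro ballI allI path_step_relations[of _ _ _ "{}", unfolded avoid_empty]
        path_step_relations; auto)+
  note \<rho> = separated_cohn_path_algebra_coset_operator[OF assms(1,3) rel(1)]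
  note \<sigma> = separated_cohn_path_algebra_coset_operator[OF assms(1,3) rel(2)]
  have unit: "cohn_unit G \<in> carrier (free_algebra (cohn_generators G) :: (('v, 'e) cohn_generator word \<Rightarrow>\<^sub>0 'k) ring)"
  proof -
    have "(\<Sum>v\<in>V. gen (Vertex v)) \<in> carrier (free_algebra (cohn_generators G) :: (('v, 'e) cohn_generator word \<Rightarrow>\<^sub>0 'k) ring)"
      if "V \<subseteq> verts G" for V
      using finite_subset[OF that finite_verts] that
      by (induction V rule: finite_induct)
        (auto intro!: free_algebra_closed gen_in_carrier simp: cohn_generators_def)
    then show ?thesis by (simp add: cohn_unit_def)
  qed
  have "m = n" if "right_module_isomorphic ?R (free_right_module ?R m) (free_right_module ?R n)" for m n
  proof (rule free_ranks_eq_of_finite_difference[OF \<rho>(1) \<sigma>(1) _ _ Z _ that])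
    show "coset_operator \<theta> \<one>\<^bsub>?R\<^esub> f x =
        (if x \<in> verts G \<times> UNIV then f x else 0)" for f x
      unfolding \<rho>(3) \<rho>(4)[OF unit] unfolding \<theta>_def
      using word_operator_cohn_unit[of G "{}" f x] by simp
    show "coset_operator (avoid Z \<theta>) \<one>\<^bsub>?R\<^esub> f x =
        (if x \<in> verts G \<times> UNIV - Z then f x else 0)" for f x
      unfolding \<sigma>(3) \<sigma>(4)[OF unit] unfolding \<theta>_def
      by (rule word_operator_cohn_unit) simp
  next
    fix a assume "a \<in> carrier ?R"
    then obtain p where p: "p \<in> carrier (free_algebra (cohn_generators G))"
      "a = cohn_ideal G P +>\<^bsub>free_algebra (cohn_generators G)\<^esub> p"
      unfolding \<rho>(2) by (auto simp: augmentation_ideal_def)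
    then show "finite {x. \<exists>f. coset_operator \<theta> a f x \<noteq>
        coset_operator (avoid Z \<theta>) a f x}"
      unfolding p(2) \<rho>(4)[OF p(1)] \<sigma>(4)[OF p(1)] unfolding \<theta>_def
      by (intro finite_word_operator_avoid_neq[OF Z(1) p(1)] path_step_inj)
  qed
  then show ?thesis
    unfolding has_IBN_def
    by (intro conjI allI impI notI ring_separated_cohn_path_algebra assms(1,3)) metis
qed

end
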